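(* Let $\alpha,\beta\in\mathbb{K}^*$ be roots of unity with $\alpha\beta\neq 1$ and $\alpha\beta^{-1}\neq 1$, and let $l=\operatorname{lcm}(\operatorname{ord}(\alpha),\operatorname{ord}(\beta))$. Assume that $\operatorname{ord}(\alpha\beta)=\operatorname{ord}(\alpha\beta^{-1})=l$. Then the center of $M_2(\alpha,\beta)$ is the polynomial algebra over $\mathbb{K}$ generated by $X_{11}^l, X_{12}^l, X_{21}^l$ and $X_{22}^l$.
   Context: $\mathbb{K}$ is an algebraically closed field of arbitrary characteristic and $\mathbb{K}^*=\mathbb{K}\setminus\{0\}$. For a root of unity $\xi\in\mathbb{K}^*$, $\operatorname{ord}(\xi)$ is its order in the group $\mathbb{K}^*$. For $\alpha,\beta\in\mathbb{K}^*$, the two-parameter quantum matrix algebra $M_2(\alpha,\beta)$ is the associative unital $\mathbb{K}$-algebra generated by $X_{11},X_{12},X_{21},X_{22}$ subject to the relations $X_{12}X_{11}=\alpha X_{11}X_{12}$, $X_{22}X_{21}=\alpha X_{21}X_{22}$, $X_{21}X_{11}=\beta X_{11}X_{21}$, $X_{22}X_{12}=\beta X_{12}X_{22}$, $X_{21}X_{12}=\beta\alpha^{-1}X_{12}X_{21}$, $X_{22}X_{11}-X_{11}X_{22}=(\beta-\alpha^{-1})X_{12}X_{21}$. *)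

theory Defs
  imports "HOL-Algebra.Algebraic_Closure_Type" "HOL-Library.Poly_Mapping"
begin

section \<open>Free associative algebras\<close>

text \<open>Words are written additively because the convolution product on
  \<open>'m \<Rightarrow>\<^sub>0 'k\<close> is defined for additive monoids \<open>'m\<close>.
  Thus \<open>0\<close> is the empty word and \<open>+\<close> is (non-commutative) concatenation.\<close>

datatype 'a word = Word "'a list"

instantiation word :: (type) monoid_add
begin

definition zero_word :: "'a word" where "0 = Word []"

fun plus_word :: "'a word \<Rightarrow> 'a word \<Rightarrow> 'a word" where
  "Word u + Word v = Word (u @ v)"

instance
proof
  fix a b c :: "'a word"
  show "a + b + c = a + (b + c)" by (cases a; cases b; cases c) simp
  show "0 + a = a" by (cases a) (simp add: zero_word_def)
  show "a + 0 = a" by (cases a) (simp add: zero_word_def)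
qed

end

text \<open>The monoid algebra of the free monoid on \<open>'g\<close>, i.e. the free associative unital
  \<open>'k\<close>-algebra.\<close>

type_synonym ('g, 'k) free_algebra = "'g word \<Rightarrow>\<^sub>0 'k"

definition fa_scalar :: "'k \<Rightarrow> ('g, 'k::field) free_algebra" where
  "fa_scalar c = Poly_Mapping.single 0 c"

definition fa_gen :: "'g \<Rightarrow> ('g, 'k::field) free_algebra" where
  "fa_gen g = Poly_Mapping.single (Word [g]) 1"

section \<open>The two-parameter quantum matrix algebra\<close>

datatype mgen = X11 | X12 | X21 | X22

definition qmat_relations :: "'k::field \<Rightarrow> 'k \<Rightarrow> (mgen, 'k) free_algebra set" where
  "qmat_relations \<alpha> \<beta> =
    (let x11 = fa_gen X11; x12 = fa_gen X12; x21 = fa_gen X21; x22 = fa_gen X22 in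
     { x12 * x11 - fa_scalar \<alpha> * x11 * x12,
       x22 * x21 - fa_scalar \<alpha> * x21 * x22,
       x21 * x11 - fa_scalar \<beta> * x11 * x21,
       x22 * x12 - fa_scalar \<beta> * x12 * x22,
       x21 * x12 - fa_scalar (\<beta> * inverse \<alpha>) * x12 * x21,
       (x22 * x11 - x11 * x22) - fa_scalar (\<beta> - inverse \<alpha>) * x12 * x21 })"

definition qmat_ideal :: "'k::field \<Rightarrow> 'k \<Rightarrow> (mgen, 'k) free_algebra set" where
  "qmat_ideal \<alpha> \<beta> = genideal ring_of_type_algebra (qmat_relations \<alpha> \<beta>)"

definition qmat :: "'k::field \<Rightarrow> 'k \<Rightarrow> (mgen, 'k) free_algebra set ring" where
  "qmat \<alpha> \<beta> = ring_of_type_algebra Quot qmat_ideal \<alpha> \<beta>"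

definition qmat_class ::
  "'k::field \<Rightarrow> 'k \<Rightarrow> (mgen, 'k) free_algebra \<Rightarrow> (mgen, 'k) free_algebra set" where
  "qmat_class \<alpha> \<beta> a = qmat_ideal \<alpha> \<beta> +>\<^bsub>ring_of_type_algebra\<^esub> a"

definition qmat_scalar :: "'k::field \<Rightarrow> 'k \<Rightarrow> 'k \<Rightarrow> (mgen, 'k) free_algebra set" where
  "qmat_scalar \<alpha> \<beta> c = qmat_class \<alpha> \<beta> (fa_scalar c)"

definition qmat_gen :: "'k::field \<Rightarrow> 'k \<Rightarrow> mgen \<Rightarrow> (mgen, 'k) free_algebra set" where
  "qmat_gen \<alpha> \<beta> g = qmat_class \<alpha> \<beta> (fa_gen g)"

lemma ring_1_ring_of_type_algebra: "ring (ring_of_type_algebra :: 'a::ring_1 ring)"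
proof -
  have "\<exists>y. x + y = 0 \<and> y + x = 0" for x :: 'a
    by (rule exI[of _ "- x"]) simp
  then show ?thesis
    unfolding ring_of_type_algebra_def
    by unfold_locales (auto simp: algebra_simps Units_def)
qed

lemma ideal_qmat_ideal: "ideal (qmat_ideal \<alpha> \<beta>) ring_of_type_algebra"
  unfolding qmat_ideal_def
  by (rule ring.genideal_ideal[OF ring_1_ring_of_type_algebra])
     (simp add: ring_of_type_algebra_def)

lemma ring_qmat: "ring (qmat \<alpha> \<beta>)"
  unfolding qmat_def by (rule ideal.quotient_is_ring[OF ideal_qmat_ideal])

section \<open>Centers and polynomial algebras\<close>

definition ring_center :: "('a, 'b) ring_scheme \<Rightarrow> 'a set" where
  "ring_center R = {z \<in> carrier R. \<forall>x \<in> carrier R. z \<otimes>\<^bsub>R\<^esub> x = x \<otimes>\<^bsub>R\<^esub> z}"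

type_synonym ('v, 'k) mpoly = "('v \<Rightarrow>\<^sub>0 nat) \<Rightarrow>\<^sub>0 'k"

definition mp_const :: "'k \<Rightarrow> ('v, 'k::field) mpoly" where
  "mp_const c = Poly_Mapping.single 0 c"

definition mp_var :: "'v \<Rightarrow> ('v, 'k::field) mpoly" where
  "mp_var v = Poly_Mapping.single (Poly_Mapping.single v 1) 1"

text \<open>The algebra \<open>A\<close>, with structure map \<open>\<iota>\<close> from the ground field, is the polynomial algebra
  on the family \<open>z\<close>: some isomorphism of algebras from the polynomial ring with variables
  indexed by \<open>'v\<close> onto \<open>A\<close> sends each variable \<open>v\<close> to \<open>z v\<close>.\<close>

definition polynomial_algebra_on ::
  "('a, 'b) ring_scheme \<Rightarrow> ('k::field \<Rightarrow> 'a) \<Rightarrow> ('v \<Rightarrow> 'a) \<Rightarrow> bool" where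
  "polynomial_algebra_on A \<iota> z \<longleftrightarrow>
    (\<exists>\<phi> \<in> ring_iso (ring_of_type_algebra :: ('v, 'k) mpoly ring) A.
       (\<forall>c. \<phi> (mp_const c) = \<iota> c) \<and> (\<forall>v. \<phi> (mp_var v) = z v))"

definition mult_ord :: "'k::field \<Rightarrow> nat" where
  "mult_ord \<xi> = group.ord (mult_of ring_of_type_algebra) \<xi>"

end

theory Submission
  imports Defs
begin

text \<open>The four generators act from the left and from the right on the vector space \<open>V\<close> with basis
  the ordered monomials \<open>X11 ^ i * X12 ^ j * X21 ^ k * X22 ^ m\<close>. Because the left operators commute
  with the right ones, the words that annihilate the vector \<open>1\<close> span a two-sided ideal; it contains
  the relations, and straightening shows that it is no larger than the ideal they generate. So the
  algebra is identified with \<open>V\<close>, and an element is central iff the left and right action of every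
  generator agree on it. For a central element, compare leading coefficients at a monomial not of
  the form \<open>(li, lj, lk, lm)\<close> whose degree \<open>j + k\<close> in \<open>X12, X21\<close> is minimal: this yields four equations
  between powers of \<open>\<alpha>\<close> and \<open>\<beta>\<close> that force \<open>l\<close> to divide all four exponents, a contradiction.\<close>

section \<open>Linear extension of maps on a basis\<close>

abbreviation lookup :: "('a \<Rightarrow>\<^sub>0 'b::zero) \<Rightarrow> 'a \<Rightarrow> 'b" where
  "lookup \<equiv> Poly_Mapping.lookup"

abbreviation keys :: "('a \<Rightarrow>\<^sub>0 'b::zero) \<Rightarrow> 'a set" where
  "keys \<equiv> Poly_Mapping.keys"

lemma poly_mapping_add_induct [case_names single add]:
  assumes single: "\<And>x c. P (Poly_Mapping.single x c)"
    and add: "\<And>f g. P f \<Longrightarrow> P g \<Longrightarrow> P (f + g)"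
  shows "P (f :: 'a \<Rightarrow>\<^sub>0 'b::comm_monoid_add)"
proof (induction f rule: Poly_Mapping.update_induct)
  case const
  show ?case using single[of undefined 0] by simp
next
  case (update f a b)
  have "Poly_Mapping.update a b f = f + Poly_Mapping.single a b"
    using update(1)
    by (intro poly_mapping_eqI)
       (auto simp: lookup_add lookup_single lookup_update in_keys_iff when_def)
  then show ?case using update single add by metis
qed

definition smul :: "'k \<Rightarrow> ('a \<Rightarrow>\<^sub>0 'k::field) \<Rightarrow> ('a \<Rightarrow>\<^sub>0 'k)" where
  "smul c p = Poly_Mapping.map ((*) c) p"

lemma lookup_smul [simp]: "lookup (smul c p) x = c * lookup p x"
  by (simp add: smul_def Poly_Mapping.map.rep_eq when_def)

lemma smul_single [simp]: "smul c (Poly_Mapping.single x d) = Poly_Mapping.single x (c * d)"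
  by (rule poly_mapping_eqI) (simp add: lookup_single when_def)

lemma smul_add: "smul c (p + q) = smul c p + smul c q"
  by (rule poly_mapping_eqI) (simp add: lookup_add algebra_simps)

lemma smul_add_left: "smul (c + d) p = smul c p + smul d p"
  by (rule poly_mapping_eqI) (simp add: lookup_add algebra_simps)

lemma smul_smul [simp]: "smul c (smul d p) = smul (c * d) p"
  by (rule poly_mapping_eqI) (simp add: algebra_simps)

lemma smul_one [simp]: "smul 1 p = p"
  by (rule poly_mapping_eqI) simp

lemma smul_zero [simp]: "smul 0 p = 0"
  by (rule poly_mapping_eqI) simp

lemma smul_zero_right [simp]: "smul c 0 = 0"
  by (rule poly_mapping_eqI) simp

lemma smul_mult_left:
  fixes p q :: "'a::monoid_add \<Rightarrow>\<^sub>0 'k::field"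
  shows "smul c p * q = smul c (p * q)"
proof -
  have *: "smul c f = Poly_Mapping.single 0 c * f" for f :: "'a \<Rightarrow>\<^sub>0 'k"
    by (induction f rule: poly_mapping_add_induct) (simp_all add: mult_single smul_add algebra_simps)
  show ?thesis by (simp add: * mult.assoc)
qed

lemma smul_mult_right:
  fixes p q :: "'a::monoid_add \<Rightarrow>\<^sub>0 'k::field"
  shows "p * smul c q = smul c (p * q)"
proof (induction p rule: poly_mapping_add_induct)
  case (single x d)
  show ?case
    by (induction q rule: poly_mapping_add_induct) (simp_all add: mult_single smul_add algebra_simps)
qed (simp add: smul_add algebra_simps)

lemma fa_scalar_mult: "fa_scalar c * f = smul c f"
proof -
  have "fa_scalar c = smul c (1 :: ('a, 'b) free_algebra)"
    by (simp add: fa_scalar_def flip: single_one)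
  then show ?thesis by (simp add: smul_mult_left)
qed

definition lext :: "('a \<Rightarrow> ('b \<Rightarrow>\<^sub>0 'k)) \<Rightarrow> ('a \<Rightarrow>\<^sub>0 'k::field) \<Rightarrow> ('b \<Rightarrow>\<^sub>0 'k)" where
  "lext \<phi> v = (\<Sum>x\<in>keys v. smul (lookup v x) (\<phi> x))"

text \<open>Cancellation can make \<open>keys (v + w)\<close> smaller than the union of the two
  supports, so additivity needs all sums to run over one common index set.\<close>

lemma lext_superset:
  assumes "finite S" "keys v \<subseteq> S"
  shows "lext \<phi> v = (\<Sum>x\<in>S. smul (lookup v x) (\<phi> x))"
  unfolding lext_def
  by (rule sum.mono_neutral_left) (use assms in \<open>auto simp: in_keys_iff\<close>)

lemma lookup_lext: "lookup (lext \<phi> v) y = (\<Sum>x\<in>keys v. lookup v x * lookup (\<phi> x) y)"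
  by (simp add: lext_def lookup_sum)

lemma lext_single [simp]: "lext \<phi> (Poly_Mapping.single x c) = smul c (\<phi> x)"
  by (subst lext_superset[of "{x}"]) auto

lemma lext_add: "lext \<phi> (v + w) = lext \<phi> v + lext \<phi> w"
proof -
  let ?S = "keys v \<union> keys w"
  have "keys (v + w) \<subseteq> ?S" by (rule keys_add)
  then show ?thesis
    by (simp add: lext_superset[of ?S] lookup_add smul_add_left sum.distrib)
qed

lemma lext_smul: "lext \<phi> (smul c v) = smul c (lext \<phi> v)"
  by (induction v rule: poly_mapping_add_induct) (simp_all add: lext_add smul_add)

lemma lext_zero [simp]: "lext \<phi> 0 = 0"
  by (simp add: lext_def)

lemma lext_diff: "lext \<phi> (v - w) = lext \<phi> v - lext \<phi> w"
  using lext_add[of \<phi> "v - w" w] by (simp add: algebra_simps)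

lemma lext_lext: "lext \<phi> (lext \<psi> v) = lext (\<lambda>x. lext \<phi> (\<psi> x)) v"
  by (induction v rule: poly_mapping_add_induct) (simp_all add: lext_add lext_smul)

lemma lext_single_id [simp]: "lext (\<lambda>x. Poly_Mapping.single x 1) v = v"
  by (induction v rule: poly_mapping_add_induct) (simp_all add: lext_add)

lemma lext_cong: "(\<And>x. x \<in> keys v \<Longrightarrow> \<phi> x = \<psi> x) \<Longrightarrow> lext \<phi> v = lext \<psi> v"
  unfolding lext_def by (rule sum.cong) auto

text \<open>If no other basis vector in the support of \<open>v\<close> has an image meeting
  \<open>y\<close>, nothing can cancel there. Leading coefficients are read off in this way.\<close>

lemma lookup_lext_isolated:
  assumes "x \<in> keys v" "\<And>x'. x' \<in> keys v \<Longrightarrow> x' \<noteq> x \<Longrightarrow> lookup (\<phi> x') y = 0"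
  shows "lookup (lext \<phi> v) y = lookup v x * lookup (\<phi> x) y"
  unfolding lookup_lext by (subst sum.remove[OF _ assms(1)]) (simp_all add: assms(2))

section \<open>Left and right multiplication on the span of the ordered monomials\<close>

type_synonym exps = "nat \<times> nat \<times> nat \<times> nat"

abbreviation mon :: "'a \<Rightarrow> 'a \<Rightarrow>\<^sub>0 'k::field" where
  "mon x \<equiv> Poly_Mapping.single x 1"

locale quantum_matrices =
  fixes \<alpha> \<beta> :: "'k::field"
  assumes \<alpha>_nz [simp]: "\<alpha> \<noteq> 0" and \<beta>_nz [simp]: "\<beta> \<noteq> 0"
begin

text \<open>A closed form of a geometric sum with ratio \<open>\<alpha> * \<beta>\<close> and first
  term \<open>\<beta> - inverse \<alpha>\<close>. Moving \<open>X22\<close> past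
  \<open>X11 ^ n\<close> creates \<open>cc n\<close> times
  \<open>X11 ^ (n - 1) * X12 * X21\<close>.\<close>

definition cc :: "nat \<Rightarrow> 'k" where
  "cc n = ((\<alpha> * \<beta>) ^ n - 1) / \<alpha>"

lemma cc_0 [simp]: "cc 0 = 0" and cc_Suc: "cc (Suc n) = \<alpha> * \<beta> * cc n + (\<beta> - inverse \<alpha>)"
  by (simp_all add: cc_def field_simps)

text \<open>The tuple \<open>(i, j, k, m)\<close> stands for the monomial
  \<open>X11 ^ i * X12 ^ j * X21 ^ k * X22 ^ m\<close>. The truncated subtractions are harmless,
  because \<open>cc 0 = 0\<close>.\<close>

fun lmul_mon :: "mgen \<Rightarrow> exps \<Rightarrow> exps \<Rightarrow>\<^sub>0 'k" where
  "lmul_mon X11 (i, j, k, m) = mon (Suc i, j, k, m)"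
| "lmul_mon X12 (i, j, k, m) = Poly_Mapping.single (i, Suc j, k, m) (\<alpha> ^ i)"
| "lmul_mon X21 (i, j, k, m) = Poly_Mapping.single (i, j, Suc k, m) (\<beta> ^ i * (\<beta> / \<alpha>) ^ j)"
| "lmul_mon X22 (i, j, k, m) = Poly_Mapping.single (i, j, k, Suc m) (\<beta> ^ j * \<alpha> ^ k)
     + Poly_Mapping.single (i - 1, Suc j, Suc k, m) (cc i * (\<beta> / \<alpha>) ^ j)"

text \<open>The generator enters at the right end and moves leftwards. The correction now arises
  when \<open>X11\<close> passes \<open>X22 ^ m\<close>, again with coefficient
  \<open>cc\<close>.\<close>

fun rmul_mon :: "mgen \<Rightarrow> exps \<Rightarrow> exps \<Rightarrow>\<^sub>0 'k" where
  "rmul_mon X11 (i, j, k, m) = Poly_Mapping.single (Suc i, j, k, m) (\<alpha> ^ j * \<beta> ^ k)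
     + Poly_Mapping.single (i, Suc j, Suc k, m - 1) (cc m * (\<beta> / \<alpha>) ^ k)"
| "rmul_mon X12 (i, j, k, m) = Poly_Mapping.single (i, Suc j, k, m) (\<beta> ^ m * (\<beta> / \<alpha>) ^ k)"
| "rmul_mon X21 (i, j, k, m) = Poly_Mapping.single (i, j, Suc k, m) (\<alpha> ^ m)"
| "rmul_mon X22 (i, j, k, m) = mon (i, j, k, Suc m)"

definition lmul :: "mgen \<Rightarrow> (exps \<Rightarrow>\<^sub>0 'k) \<Rightarrow> exps \<Rightarrow>\<^sub>0 'k" where
  "lmul g = lext (lmul_mon g)"

definition rmul :: "mgen \<Rightarrow> (exps \<Rightarrow>\<^sub>0 'k) \<Rightarrow> exps \<Rightarrow>\<^sub>0 'k" where
  "rmul g = lext (rmul_mon g)"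

lemma lmul_X22_rmul_X11_mon:
  "lext (lmul_mon X22) (rmul_mon X11 (i, j, k, m)) = lext (rmul_mon X11) (lmul_mon X22 (i, j, k, m))"
proof -
  let ?s = Poly_Mapping.single
  \<comment> \<open>Both operators have a correction term here. The identity compares the
    coefficients at \<open>(i, Suc j, Suc k, m)\<close>, the only monomial that each side reaches in
    two ways.\<close>
  have e: "\<alpha> ^ j * \<beta> ^ k * (cc (Suc i) * (\<beta> / \<alpha>) ^ j) + cc m * (\<beta> / \<alpha>) ^ k * (\<beta> ^ Suc j * \<alpha> ^ Suc k)
      = \<beta> ^ j * \<alpha> ^ k * (cc (Suc m) * (\<beta> / \<alpha>) ^ k) + cc i * (\<beta> / \<alpha>) ^ j * (\<alpha> ^ Suc j * \<beta> ^ Suc k)"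
    by (simp add: cc_Suc field_simps)
  show ?thesis
    using arg_cong[OF e, of "?s (i, Suc j, Suc k, m)"]
    by (cases i; cases m) (simp_all add: lext_add smul_add single_add algebra_simps)
qed

text \<open>Basis vectors suffice. Apart from \<open>X22\<close> on the left with \<open>X11\<close>
  on the right, at most one of the two operators has a correction term, and the coefficients agree
  term by term.\<close>

lemma lmul_rmul: "lmul g (rmul h v) = rmul h (lmul g v)"
proof -
  have "lext (lmul_mon g) (rmul_mon h x) = lext (rmul_mon h) (lmul_mon g x)" for x
  proof -
    obtain i j k m where x: "x = (i, j, k, m)" by (cases x) auto
    show ?thesis
    proof (cases "g = X22 \<and> h = X11")
      case True
      then show ?thesis using lmul_X22_rmul_X11_mon by (simp add: x)
    next
      case False
      then show ?thesis
        unfolding x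
        by (cases i; cases m; cases g; cases h) (simp_all add: lext_add smul_add field_simps)
    qed
  qed
  then show ?thesis by (simp add: lmul_def rmul_def lext_lext)
qed

lemma lmul_add: "lmul g (v + w) = lmul g v + lmul g w" by (simp add: lmul_def lext_add)
lemma lmul_smul: "lmul g (smul c v) = smul c (lmul g v)" by (simp add: lmul_def lext_smul)
lemma lmul_zero [simp]: "lmul g 0 = 0" by (simp add: lmul_def)
lemma lmul_single: "lmul g (Poly_Mapping.single x c) = smul c (lmul_mon g x)" by (simp add: lmul_def)
lemma rmul_add: "rmul g (v + w) = rmul g v + rmul g w" by (simp add: rmul_def lext_add)
lemma rmul_smul: "rmul g (smul c v) = smul c (rmul g v)" by (simp add: rmul_def lext_smul)
lemma rmul_zero [simp]: "rmul g 0 = 0" by (simp add: rmul_def)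
lemma rmul_single: "rmul g (Poly_Mapping.single x c) = smul c (rmul_mon g x)" by (simp add: rmul_def)

section \<open>Normal forms\<close>

fun word_nf :: "mgen word \<Rightarrow> exps \<Rightarrow>\<^sub>0 'k" where
  "word_nf (Word gs) = foldr lmul gs (mon (0, 0, 0, 0))"

definition nf :: "(mgen, 'k) free_algebra \<Rightarrow> exps \<Rightarrow>\<^sub>0 'k" where
  "nf = lext word_nf"

lemma nf_add: "nf (f + h) = nf f + nf h" by (simp add: nf_def lext_add)
lemma nf_diff: "nf (f - h) = nf f - nf h" by (simp add: nf_def lext_diff)
lemma nf_smul: "nf (smul c f) = smul c (nf f)" by (simp add: nf_def lext_smul)
lemma nf_zero [simp]: "nf 0 = 0" by (simp add: nf_def)

lemma nf_one: "nf (1 :: (mgen, 'k) free_algebra) = mon (0, 0, 0, 0)"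
  by (simp add: nf_def zero_word_def flip: single_one)

lemma nf_gen_mult: "nf (fa_gen g * f) = lmul g (nf f)"
proof (induction f rule: poly_mapping_add_induct)
  case (single w c)
  then show ?case by (cases w) (simp add: nf_def fa_gen_def mult_single lmul_smul)
qed (simp add: nf_add lmul_add algebra_simps)

text \<open>The last letter acts first, on the vector of the empty monomial, where left and right
  action agree. By \<open>lmul_rmul\<close> its right action then moves out past all the other
  letters.\<close>

lemma nf_mult_gen: "nf (f * fa_gen g) = rmul g (nf f)"
proof (induction f rule: poly_mapping_add_induct)
  case (single w c)
  have "foldr lmul gs (lmul g (mon (0, 0, 0, 0))) = rmul g (foldr lmul gs (mon (0, 0, 0, 0)))" for gs
    by (induction gs) (cases g, simp_all add: lmul_rmul lmul_single rmul_single)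
  then show ?case by (cases w) (simp add: nf_def fa_gen_def mult_single rmul_smul)
qed (simp add: nf_add rmul_add algebra_simps)

lemma nf_gen: "nf (fa_gen g) = lmul g (mon (0, 0, 0, 0))"
  by (simp add: nf_def fa_gen_def)

section \<open>The kernel of the normal form map\<close>

lemma single_Word_Cons: "Poly_Mapping.single (Word (g # gs)) c = fa_gen g * Poly_Mapping.single (Word gs) c"
  by (simp add: fa_gen_def mult_single)

lemma single_Word_snoc: "Poly_Mapping.single (Word (gs @ [g])) c = Poly_Mapping.single (Word gs) c * fa_gen g"
  by (simp add: fa_gen_def mult_single)

lemma single_Word_Nil: "Poly_Mapping.single (Word []) c = smul c 1"
  by (simp flip: zero_word_def single_one)

text \<open>Each letter put in front of \<open>f\<close> acts on the normal form by a linear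
  operator, so zero stays zero.\<close>

lemma nf_mult_eq_0_right: "nf f = 0 \<Longrightarrow> nf (h * f) = 0"
proof (induction h rule: poly_mapping_add_induct)
  case (single w c)
  have "nf (Poly_Mapping.single (Word gs) c * f) = 0" for gs
    using single
    by (induction gs) (simp_all add: single_Word_Nil single_Word_Cons smul_mult_left nf_smul
        mult.assoc nf_gen_mult)
  then show ?case by (cases w) auto
qed (simp add: nf_add algebra_simps)

text \<open>The mirror argument: letters appended on the right act through
  \<open>rmul\<close>.\<close>

lemma nf_mult_eq_0_left: "nf f = 0 \<Longrightarrow> nf (f * h) = 0"
proof (induction h rule: poly_mapping_add_induct)
  case (single w c)
  have "nf (f * Poly_Mapping.single (Word gs) c) = 0" for gs
    using single
    by (induction gs rule: rev_induct) (simp_all add: single_Word_Nil single_Word_snoc smul_mult_right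
        nf_smul nf_mult_gen flip: mult.assoc)
  then show ?case by (cases w) auto
qed (simp add: nf_add algebra_simps)

lemma ideal_nf_kernel: "ideal {f. nf f = 0} (ring_of_type_algebra :: (mgen, 'k) free_algebra ring)"
proof -
  interpret R: ring "ring_of_type_algebra :: (mgen, 'k) free_algebra ring"
    by (rule ring_1_ring_of_type_algebra)
  have inv: "\<ominus>\<^bsub>ring_of_type_algebra\<^esub> f = - f" for f :: "(mgen, 'k) free_algebra"
    unfolding a_inv_def
    by (rule group.inv_equality[OF R.add.is_group]) (simp_all add: ring_of_type_algebra_def)
  show ?thesis
  proof (rule idealI)
    show "subgroup {f. nf f = 0} (add_monoid (ring_of_type_algebra :: (mgen, 'k) free_algebra ring))"
    proof (rule R.add.subgroupI)
      fix f assume "f \<in> {f. nf f = 0}"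
      then show "\<ominus>\<^bsub>ring_of_type_algebra\<^esub> f \<in> {f. nf f = 0}"
        using nf_diff[of 0 f] by (simp add: inv)
    qed (auto simp: nf_add ring_of_type_algebra_def intro!: exI[of _ 0])
  qed (rule ring_1_ring_of_type_algebra,
       auto simp: ring_of_type_algebra_def nf_mult_eq_0_right nf_mult_eq_0_left)
qed

text \<open>The generated ideal is the least one containing the relations, so only the six relations
  have to be evaluated.\<close>

lemma nf_eq_0_if_mem_ideal: "f \<in> qmat_ideal \<alpha> \<beta> \<Longrightarrow> nf f = 0"
proof -
  assume f: "f \<in> qmat_ideal \<alpha> \<beta>"
  have "qmat_relations \<alpha> \<beta> \<subseteq> {f. nf f = 0}"
    by (auto simp: qmat_relations_def Let_def nf_diff nf_add fa_scalar_mult smul_mult_left nf_smul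
        nf_gen_mult nf_gen lmul_single cc_Suc field_simps lmul_add smul_add single_diff)
  then have "qmat_ideal \<alpha> \<beta> \<subseteq> {f. nf f = 0}"
    unfolding qmat_ideal_def
    by (rule ring.genideal_minimal[OF ring_1_ring_of_type_algebra ideal_nf_kernel])
  then show ?thesis using f by auto
qed

section \<open>Congruence modulo the ideal of relations\<close>

definition cong :: "(mgen, 'k) free_algebra \<Rightarrow> (mgen, 'k) free_algebra \<Rightarrow> bool" (infix \<open>\<asymp>\<close> 50) where
  "f \<asymp> h \<longleftrightarrow> f - h \<in> qmat_ideal \<alpha> \<beta>"

lemma ideal_add: "f \<in> qmat_ideal \<alpha> \<beta> \<Longrightarrow> h \<in> qmat_ideal \<alpha> \<beta> \<Longrightarrow> f + h \<in> qmat_ideal \<alpha> \<beta>"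
  using additive_subgroup.a_closed[OF ideal.axioms(1)[OF ideal_qmat_ideal], of f \<alpha> \<beta> h]
  by (simp add: ring_of_type_algebra_def)

lemma ideal_mult_left: "f \<in> qmat_ideal \<alpha> \<beta> \<Longrightarrow> h * f \<in> qmat_ideal \<alpha> \<beta>"
  using ideal.I_l_closed[OF ideal_qmat_ideal, of f \<alpha> \<beta> h]
  by (simp add: ring_of_type_algebra_def)

lemma ideal_mult_right: "f \<in> qmat_ideal \<alpha> \<beta> \<Longrightarrow> f * h \<in> qmat_ideal \<alpha> \<beta>"
  using ideal.I_r_closed[OF ideal_qmat_ideal, of f \<alpha> \<beta> h]
  by (simp add: ring_of_type_algebra_def)

lemma cong_refl [simp]: "f \<asymp> f"
  using additive_subgroup.zero_closed[OF ideal.axioms(1)[OF ideal_qmat_ideal], of \<alpha> \<beta>]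
  by (simp add: cong_def ring_of_type_algebra_def)

lemma cong_trans [trans]: "f \<asymp> g \<Longrightarrow> g \<asymp> h \<Longrightarrow> f \<asymp> h"
  unfolding cong_def using ideal_add[of "f - g" "g - h"] by simp

lemma cong_sym: "f \<asymp> g \<Longrightarrow> g \<asymp> f"
  unfolding cong_def using ideal_mult_left[of "f - g" "-1"] by simp

lemma cong_add: "f \<asymp> f' \<Longrightarrow> g \<asymp> g' \<Longrightarrow> f + g \<asymp> f' + g'"
  unfolding cong_def using ideal_add[of "f - f'" "g - g'"] by (simp add: algebra_simps)

lemma cong_mult_left: "f \<asymp> g \<Longrightarrow> h * f \<asymp> h * g"
  unfolding cong_def using ideal_mult_left[of "f - g" h] by (simp add: algebra_simps)

lemma cong_mult_right: "f \<asymp> g \<Longrightarrow> f * h \<asymp> g * h"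
  unfolding cong_def using ideal_mult_right[of "f - g" h] by (simp add: algebra_simps)

lemma cong_smul: "f \<asymp> g \<Longrightarrow> smul c f \<asymp> smul c g"
  using cong_mult_left[of f g "fa_scalar c"] by (simp add: fa_scalar_mult)

lemma cong_imp_nf_eq: "f \<asymp> g \<Longrightarrow> nf f = nf g"
  using nf_eq_0_if_mem_ideal[of "f - g"] by (simp add: cong_def nf_diff)

lemma swap_power:
  assumes "y * x \<asymp> smul q (x * y)"
  shows "y * x ^ n \<asymp> smul (q ^ n) (x ^ n * y)"
proof (induction n)
  case (Suc n)
  have "y * x ^ Suc n = y * x * x ^ n" by (simp add: mult.assoc)
  also have "\<dots> \<asymp> smul q (x * y) * x ^ n" by (rule cong_mult_right) fact
  also have "\<dots> = smul q x * (y * x ^ n)" by (simp add: smul_mult_left mult.assoc)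
  also have "\<dots> \<asymp> smul q x * smul (q ^ n) (x ^ n * y)" by (rule cong_mult_left) fact
  also have "\<dots> = smul (q ^ Suc n) (x ^ Suc n * y)"
    by (simp add: smul_mult_left smul_mult_right mult.assoc mult.commute[of q])
  finally show ?case .
qed simp

section \<open>Straightening products of generators\<close>

abbreviation "A \<equiv> fa_gen X11 :: (mgen, 'k) free_algebra"
abbreviation "B \<equiv> fa_gen X12 :: (mgen, 'k) free_algebra"
abbreviation "C \<equiv> fa_gen X21 :: (mgen, 'k) free_algebra"
abbreviation "D \<equiv> fa_gen X22 :: (mgen, 'k) free_algebra"

lemma straighten:
  "B * A \<asymp> smul \<alpha> (A * B)"
  "D * C \<asymp> smul \<alpha> (C * D)"
  "C * A \<asymp> smul \<beta> (A * C)"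
  "D * B \<asymp> smul \<beta> (B * D)"
  "C * B \<asymp> smul (\<beta> / \<alpha>) (B * C)"
  "D * A \<asymp> A * D + smul (\<beta> - inverse \<alpha>) (B * C)"
proof -
  have "qmat_relations \<alpha> \<beta> \<subseteq> qmat_ideal \<alpha> \<beta>"
    unfolding qmat_ideal_def
    by (rule ring.genideal_self[OF ring_1_ring_of_type_algebra]) (simp add: ring_of_type_algebra_def)
  then show
    "B * A \<asymp> smul \<alpha> (A * B)"
    "D * C \<asymp> smul \<alpha> (C * D)"
    "C * A \<asymp> smul \<beta> (A * C)"
    "D * B \<asymp> smul \<beta> (B * D)"
    "C * B \<asymp> smul (\<beta> / \<alpha>) (B * C)"
    "D * A \<asymp> A * D + smul (\<beta> - inverse \<alpha>) (B * C)"
    by (simp_all add: qmat_relations_def Let_def cong_def fa_scalar_mult smul_mult_left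
        divide_inverse diff_diff_eq)
qed

text \<open>When \<open>D\<close> passes the first \<open>A\<close>, a multiple of
  \<open>B * C\<close> is left in front of \<open>A ^ n\<close>. Moving it to the right of
  \<open>A ^ n\<close> costs \<open>(\<alpha> * \<beta>) ^ n\<close>, and these contributions add up
  to \<open>cc\<close>.\<close>

lemma straighten_D_A_power: "D * A ^ n \<asymp> A ^ n * D + smul (cc n) (A ^ (n - 1) * B * C)"
proof (induction n)
  case (Suc n)
  let ?g = "\<beta> - inverse \<alpha>"
  have "B * (C * A ^ n) \<asymp> B * smul (\<beta> ^ n) (A ^ n * C)"
    by (intro cong_mult_left swap_power straighten)
  also have "\<dots> = smul (\<beta> ^ n) (B * A ^ n * C)"
    by (simp add: smul_mult_right mult.assoc)
  also have "\<dots> \<asymp> smul (\<beta> ^ n) (smul (\<alpha> ^ n) (A ^ n * B) * C)"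
    by (intro cong_smul cong_mult_right swap_power straighten)
  also have "\<dots> = smul ((\<alpha> * \<beta>) ^ n) (A ^ n * B * C)"
    by (simp add: smul_mult_left power_mult_distrib mult.commute)
  finally have BC: "B * (C * A ^ n) \<asymp> smul ((\<alpha> * \<beta>) ^ n) (A ^ n * B * C)" .
  \<comment> \<open>For \<open>n = 0\<close> the exponent \<open>n - 1\<close> is truncated, but
    both sides vanish because \<open>cc 0 = 0\<close>.\<close>
  have step: "smul (cc n) (A * (A ^ (n - 1) * B * C)) = smul (cc n) (A ^ n * B * C)"
    by (cases n) (simp_all add: mult.assoc)
  have coeff: "cc n + ?g * (\<alpha> * \<beta>) ^ n = cc (Suc n)"
    by (simp add: cc_def field_simps)
  have "D * A ^ Suc n = D * A * A ^ n" by (simp add: mult.assoc)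
  also have "\<dots> \<asymp> (A * D + smul ?g (B * C)) * A ^ n"
    by (intro cong_mult_right straighten)
  also have "\<dots> = A * (D * A ^ n) + smul ?g (B * (C * A ^ n))"
    by (simp add: algebra_simps smul_mult_left)
  also have "\<dots> \<asymp> A * (A ^ n * D + smul (cc n) (A ^ (n - 1) * B * C))
      + smul ?g (smul ((\<alpha> * \<beta>) ^ n) (A ^ n * B * C))"
    by (intro cong_add cong_mult_left cong_smul BC Suc)
  also have "\<dots> = A ^ Suc n * D + (smul (cc n) (A ^ n * B * C) + smul (?g * (\<alpha> * \<beta>) ^ n) (A ^ n * B * C))"
    using step by (simp add: distrib_left smul_mult_right mult.assoc)
  also have "\<dots> = A ^ Suc n * D + smul (cc (Suc n)) (A ^ n * B * C)"
    by (simp add: coeff flip: smul_add_left)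
  finally show ?case by simp
qed simp

section \<open>Ordered monomials as a basis of the quotient\<close>

fun ordmon :: "exps \<Rightarrow> (mgen, 'k) free_algebra" where
  "ordmon (i, j, k, m) = A ^ i * B ^ j * C ^ k * D ^ m"

definition lift :: "(exps \<Rightarrow>\<^sub>0 'k) \<Rightarrow> (mgen, 'k) free_algebra" where
  "lift = lext ordmon"

text \<open>This ties the coefficients chosen in \<open>lmul_mon\<close> to the algebra:
  straightening with the relations produces exactly these operators.\<close>

lemma gen_mult_ordmon: "fa_gen g * ordmon x \<asymp> lift (lmul_mon g x)"
proof -
  obtain i j k m where x: "x = (i, j, k, m)" by (cases x) auto
  have CB: "C * B ^ j \<asymp> smul ((\<beta> / \<alpha>) ^ j) (B ^ j * C)"
    by (rule swap_power) (rule straighten)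
  show ?thesis
  proof (cases g)
    case X11
    then show ?thesis by (simp add: x lift_def mult.assoc)
  next
    case X12
    have "B * A ^ i * (B ^ j * C ^ k * D ^ m) \<asymp> smul (\<alpha> ^ i) (A ^ i * B) * (B ^ j * C ^ k * D ^ m)"
      by (intro cong_mult_right swap_power straighten)
    then show ?thesis using X12 by (simp add: x lift_def mult.assoc smul_mult_left)
  next
    case X21
    have "C * A ^ i * (B ^ j * C ^ k * D ^ m) \<asymp> smul (\<beta> ^ i) (A ^ i * C) * (B ^ j * C ^ k * D ^ m)"
      by (intro cong_mult_right swap_power straighten)
    also have "\<dots> = smul (\<beta> ^ i) (A ^ i * (C * B ^ j) * (C ^ k * D ^ m))"
      by (simp add: smul_mult_left mult.assoc)
    also have "\<dots> \<asymp> smul (\<beta> ^ i) (A ^ i * smul ((\<beta> / \<alpha>) ^ j) (B ^ j * C) * (C ^ k * D ^ m))"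
      by (intro cong_smul cong_mult_right cong_mult_left CB)
    finally show ?thesis using X21 by (simp add: x lift_def mult.assoc smul_mult_left smul_mult_right)
  next
    case X22
    \<comment> \<open>Once \<open>D\<close> has passed \<open>A ^ i\<close>, two terms remain: one
      with \<open>D\<close> and one with \<open>B * C\<close> in front of \<open>?r\<close>. They
      are straightened separately in \<open>1\<close> and \<open>2\<close>.\<close>
    let ?r = "B ^ j * C ^ k * D ^ m"
    have "D * ?r = D * B ^ j * (C ^ k * D ^ m)" by (simp add: mult.assoc)
    also have "\<dots> \<asymp> smul (\<beta> ^ j) (B ^ j * D) * (C ^ k * D ^ m)"
      by (intro cong_mult_right swap_power straighten)
    also have "\<dots> = smul (\<beta> ^ j) (B ^ j * (D * C ^ k) * D ^ m)"
      by (simp add: smul_mult_left mult.assoc)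
    also have "\<dots> \<asymp> smul (\<beta> ^ j) (B ^ j * smul (\<alpha> ^ k) (C ^ k * D) * D ^ m)"
      by (intro cong_smul cong_mult_right cong_mult_left swap_power straighten)
    also have "\<dots> = smul (\<beta> ^ j * \<alpha> ^ k) (B ^ j * C ^ k * D ^ Suc m)"
      by (simp add: smul_mult_left smul_mult_right mult.assoc)
    finally have 1: "D * ?r \<asymp> smul (\<beta> ^ j * \<alpha> ^ k) (B ^ j * C ^ k * D ^ Suc m)" .
    have "B * (C * ?r) = B * (C * B ^ j) * (C ^ k * D ^ m)" by (simp add: mult.assoc)
    also have "\<dots> \<asymp> B * smul ((\<beta> / \<alpha>) ^ j) (B ^ j * C) * (C ^ k * D ^ m)"
      by (intro cong_mult_right cong_mult_left CB)
    also have "\<dots> = smul ((\<beta> / \<alpha>) ^ j) (B ^ Suc j * C ^ Suc k * D ^ m)"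
      by (simp add: smul_mult_left smul_mult_right mult.assoc)
    finally have 2: "B * (C * ?r) \<asymp> smul ((\<beta> / \<alpha>) ^ j) (B ^ Suc j * C ^ Suc k * D ^ m)" .
    have "D * A ^ i * ?r \<asymp> (A ^ i * D + smul (cc i) (A ^ (i - 1) * B * C)) * ?r"
      by (intro cong_mult_right straighten_D_A_power)
    also have "\<dots> = A ^ i * (D * ?r) + smul (cc i) (A ^ (i - 1) * (B * (C * ?r)))"
      by (simp add: distrib_right smul_mult_left mult.assoc)
    also have "\<dots> \<asymp> A ^ i * smul (\<beta> ^ j * \<alpha> ^ k) (B ^ j * C ^ k * D ^ Suc m)
        + smul (cc i) (A ^ (i - 1) * smul ((\<beta> / \<alpha>) ^ j) (B ^ Suc j * C ^ Suc k * D ^ m))"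
      by (intro cong_add cong_smul cong_mult_left 1 2)
    finally show ?thesis using X22
      by (simp add: x lift_def lext_add mult.assoc smul_mult_left smul_mult_right)
  qed
qed

lemma gen_mult_lift: "fa_gen g * lift v \<asymp> lift (lmul g v)"
proof (induction v rule: poly_mapping_add_induct)
  case (single x c)
  show ?case
    using cong_smul[OF gen_mult_ordmon, of c g x]
    by (simp add: lmul_single) (simp add: lift_def lext_smul smul_mult_right)
next
  case (add v w)
  then show ?case
    using cong_add[OF add] by (simp add: lmul_add) (simp add: lift_def lext_add algebra_simps)
qed

text \<open>The spanning half of the basis property, by absorbing a word letter by letter from its
  right end.\<close>

lemma cong_lift_nf: "f \<asymp> lift (nf f)"
proof (induction f rule: poly_mapping_add_induct)
  case (single w c)
  have "Poly_Mapping.single (Word gs) c \<asymp> lift (nf (Poly_Mapping.single (Word gs) c))" for gs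
  proof (induction gs)
    case Nil
    then show ?case by (simp add: single_Word_Nil nf_smul nf_one) (simp add: lift_def)
  next
    case (Cons g gs)
    let ?f = "Poly_Mapping.single (Word gs) c"
    have "fa_gen g * ?f \<asymp> fa_gen g * lift (nf ?f)"
      by (rule cong_mult_left) fact
    also have "\<dots> \<asymp> lift (lmul g (nf ?f))"
      by (rule gen_mult_lift)
    finally show ?case by (simp add: single_Word_Cons nf_gen_mult)
  qed
  then show ?case by (cases w) simp
next
  case (add f h)
  then show ?case
    using cong_add[OF add] by (simp add: nf_add) (simp add: lift_def lext_add)
qed

text \<open>Two elements with the same normal form are both congruent to its lift, so the kernel of
  \<open>nf\<close> is no larger than the ideal.\<close>

lemma cong_iff: "f \<asymp> h \<longleftrightarrow> nf f = nf h"
  using cong_imp_nf_eq cong_lift_nf cong_trans cong_sym by metis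

lemma lift_mon [simp]: "lift (mon x) = ordmon x"
  by (simp add: lift_def)

lemma nf_power_mult: "nf (fa_gen g ^ n * f) = (lmul g ^^ n) (nf f)"
  by (induction n) (simp_all add: mult.assoc nf_gen_mult)

text \<open>The hypotheses, as in the next two lemmas, remove twist and correction. They are met
  when the exponents of the earlier generators are all 0, and later when these are multiples of
  \<open>l\<close>.\<close>

lemma lmul_pow_X22:
  "cc i = 0 \<Longrightarrow> \<beta> ^ j * \<alpha> ^ k = 1 \<Longrightarrow> (lmul X22 ^^ n) (mon (i, j, k, m)) = mon (i, j, k, n + m)"
  by (induction n) (simp_all add: lmul_single)

lemma lmul_pow_X21:
  "\<beta> ^ i * (\<beta> / \<alpha>) ^ j = 1 \<Longrightarrow> (lmul X21 ^^ n) (mon (i, j, k, m)) = mon (i, j, n + k, m)"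
  by (induction n) (simp_all add: lmul_single)

lemma lmul_pow_X12: "\<alpha> ^ i = 1 \<Longrightarrow> (lmul X12 ^^ n) (mon (i, j, k, m)) = mon (i, n + j, k, m)"
  by (induction n) (simp_all add: lmul_single)

lemma lmul_pow_X11: "(lmul X11 ^^ n) (mon (i, j, k, m)) = mon (n + i, j, k, m)"
  by (induction n) (simp_all add: lmul_single)

text \<open>The independence half of the basis property: distinct ordered monomials have distinct
  basis vectors as normal forms.\<close>

lemma nf_ordmon: "nf (ordmon x) = mon x"
proof -
  obtain i j k m where x: "x = (i, j, k, m)" by (cases x) auto
  \<comment> \<open>The trailing factor 1 lets \<open>nf_power_mult\<close> peel off the last power
    as well.\<close>
  have "nf (A ^ i * (B ^ j * (C ^ k * (D ^ m * 1)))) = mon x"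
    by (simp add: nf_power_mult nf_one lmul_pow_X22 lmul_pow_X21 lmul_pow_X12 lmul_pow_X11 x
        del: mult_1_right)
  then show ?thesis by (simp add: x mult.assoc)
qed

lemma nf_lift [simp]: "nf (lift v) = v"
proof -
  have "nf (lift v) = lext (\<lambda>x. nf (ordmon x)) v"
    by (simp add: nf_def lift_def lext_lext)
  then show ?thesis by (simp add: nf_ordmon)
qed

section \<open>The quotient ring in terms of normal forms\<close>

abbreviation "Q \<equiv> qmat \<alpha> \<beta>"
abbreviation "cls \<equiv> qmat_class \<alpha> \<beta>"

lemma ring_hom_cls: "cls \<in> ring_hom ring_of_type_algebra Q"
  unfolding qmat_class_def[abs_def] qmat_def
  by (rule ideal.rcos_ring_hom[OF ideal_qmat_ideal])

lemma cls_mult: "cls (f * h) = cls f \<otimes>\<^bsub>Q\<^esub> cls h"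
  and cls_add: "cls (f + h) = cls f \<oplus>\<^bsub>Q\<^esub> cls h"
  and cls_one: "cls 1 = \<one>\<^bsub>Q\<^esub>"
  using ring_hom_mult[OF ring_hom_cls, of f h] ring_hom_add[OF ring_hom_cls, of f h]
    ring_hom_one[OF ring_hom_cls]
  by (simp_all add: ring_of_type_algebra_def)

lemma cls_pow: "cls (f ^ n) = cls f [^]\<^bsub>Q\<^esub> n"
  by (induction n) (simp_all add: cls_one cls_mult power_Suc2 del: power_Suc)

lemma carrier_Q: "carrier Q = range cls"
  by (auto simp: qmat_def qmat_class_def FactRing_def A_RCOSETS_def' ring_of_type_algebra_def)

lemma cls_eq_iff: "cls f = cls h \<longleftrightarrow> nf f = nf h"
proof -
  have mem: "g \<in> cls f \<longleftrightarrow> g \<asymp> f" for f g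
  proof
    assume "g \<asymp> f"
    then show "g \<in> cls f"
      unfolding cong_def qmat_class_def a_r_coset_def' ring_of_type_algebra_def
      by (auto intro: bexI[of _ "g - f"])
  qed (auto simp: cong_def qmat_class_def a_r_coset_def' ring_of_type_algebra_def)
  show ?thesis by (auto simp: set_eq_iff mem cong_iff)
qed

section \<open>Centrality in terms of normal forms\<close>

definition nf_central :: "(exps \<Rightarrow>\<^sub>0 'k) \<Rightarrow> bool" where
  "nf_central v \<longleftrightarrow> (\<forall>g. lmul g v = rmul g v)"

text \<open>Commuting with the generators is enough: an element then commutes with every word,
  letter by letter, and with all linear combinations of words.\<close>

lemma cls_center_iff: "cls f \<in> ring_center Q \<longleftrightarrow> nf_central (nf f)"
proof
  assume "cls f \<in> ring_center Q"
  then have "cls (fa_gen g * f) = cls (f * fa_gen g)" for g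
    by (simp add: ring_center_def carrier_Q cls_mult)
  then show "nf_central (nf f)"
    by (simp add: cls_eq_iff nf_gen_mult nf_mult_gen nf_central_def)
next
  assume "nf_central (nf f)"
  then have gen: "f * fa_gen g \<asymp> fa_gen g * f" for g
    by (simp add: cong_iff nf_gen_mult nf_mult_gen nf_central_def)
  have "f * h \<asymp> h * f" for h
  proof (induction h rule: poly_mapping_add_induct)
    case (single w c)
    have "f * Poly_Mapping.single (Word gs) c \<asymp> Poly_Mapping.single (Word gs) c * f" for gs
    proof (induction gs)
      case (Cons g gs)
      let ?s = "Poly_Mapping.single (Word gs) c"
      have "f * (fa_gen g * ?s) = f * fa_gen g * ?s" by (simp add: mult.assoc)
      also have "\<dots> \<asymp> fa_gen g * f * ?s" by (rule cong_mult_right) (rule gen)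
      also have "\<dots> = fa_gen g * (f * ?s)" by (simp add: mult.assoc)
      also have "\<dots> \<asymp> fa_gen g * (?s * f)" by (rule cong_mult_left) fact
      finally show ?case by (simp add: single_Word_Cons mult.assoc)
    qed (simp add: single_Word_Nil smul_mult_left smul_mult_right)
    then show ?case by (cases w) simp
  qed (simp add: algebra_simps cong_add)
  then show "cls f \<in> ring_center Q"
    by (auto simp: ring_center_def carrier_Q cong_iff simp flip: cls_mult cls_eq_iff)
qed

end

section \<open>The center at roots of unity\<close>

text \<open>The assumptions on orders in the form in which they are applied, as divisibility of
  exponents by \<open>l\<close>.\<close>

locale quantum_matrices_root = quantum_matrices \<alpha> \<beta> for \<alpha> \<beta> :: "'k::field" +
  fixes l :: nat
  assumes l_pos: "l > 0"
    and \<alpha>_pow_l: "\<alpha> ^ l = 1" and \<beta>_pow_l: "\<beta> ^ l = 1"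
    and mult_pow: "(\<alpha> * \<beta>) ^ n = 1 \<Longrightarrow> l dvd n"
    and div_pow: "(\<alpha> / \<beta>) ^ n = 1 \<Longrightarrow> l dvd n"
begin

section \<open>Exponents divisible by \<open>l\<close>\<close>

lemma pow_dvd:
  assumes "l dvd n"
  shows "\<alpha> ^ n = 1" "\<beta> ^ n = 1" "cc n = 0"
proof -
  show "\<alpha> ^ n = 1" "\<beta> ^ n = 1"
    using assms by (auto elim!: dvdE simp: power_mult \<alpha>_pow_l \<beta>_pow_l)
  then show "cc n = 0" by (simp add: cc_def power_mult_distrib)
qed

fun l_exps :: "exps \<Rightarrow> bool" where
  "l_exps (i, j, k, m) \<longleftrightarrow> l dvd i \<and> l dvd j \<and> l dvd k \<and> l dvd m"

text \<open>All twists become 1 and the corrections vanish with \<open>cc i\<close> and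
  \<open>cc m\<close>, so these monomials are central.\<close>

lemma lmul_eq_rmul_l_exps: "l_exps x \<Longrightarrow> lmul_mon g x = rmul_mon g x"
  by (cases x; cases g) (simp_all add: pow_dvd power_divide)

lemma nf_ordmon_mult_l_exps:
  assumes "l_exps (i, j, k, m)" "l_exps (i', j', k', m')"
  shows "nf (ordmon (i, j, k, m) * ordmon (i', j', k', m')) = mon (i + i', j + j', k + k', m + m')"
  using assms
  \<comment> \<open>Only the first factor is unfolded. Its powers then act in turn on the basis
    vector of the second factor.\<close>
  by (simp only: ordmon.simps[of i] mult.assoc nf_power_mult nf_ordmon)
     (simp add: lmul_pow_X22 lmul_pow_X21 lmul_pow_X12 lmul_pow_X11 pow_dvd power_divide)

text \<open>The assumptions \<open>a\<close>, \<open>b\<close>, \<open>c\<close>, \<open>d\<close>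
  are the leading coefficient equations for \<open>X11\<close>, \<open>X12\<close>,
  \<open>X21\<close>, \<open>X22\<close>. The product of \<open>a\<close> and \<open>d\<close>
  controls \<open>j + k\<close>, and \<open>a\<close> then controls \<open>j\<close> alone.\<close>

lemma l_exps_if_power_relations:
  assumes a: "\<alpha> ^ j * \<beta> ^ k = 1" and d: "\<beta> ^ j * \<alpha> ^ k = 1"
    and b: "\<alpha> ^ i = \<beta> ^ m * (\<beta> / \<alpha>) ^ k" and c: "\<beta> ^ i * (\<beta> / \<alpha>) ^ j = \<alpha> ^ m"
  shows "l_exps (i, j, k, m)"
proof -
  have "(\<alpha> * \<beta>) ^ (j + k) = (\<alpha> ^ j * \<beta> ^ k) * (\<beta> ^ j * \<alpha> ^ k)"
    by (simp add: power_add power_mult_distrib)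
  then have jk: "l dvd j + k" using a d mult_pow by simp
  then have "\<beta> ^ j * \<beta> ^ k = \<alpha> ^ j * \<beta> ^ k"
    using a pow_dvd(2) by (simp flip: power_add)
  then have "(\<alpha> / \<beta>) ^ j = 1" by (simp add: power_divide)
  then have j: "l dvd j" by (rule div_pow)
  with jk have k: "l dvd k" by (simp add: dvd_add_right_iff)
  \<comment> \<open>With \<open>j\<close> and \<open>k\<close> settled, only a symmetric pair of
    equations in \<open>i\<close> and \<open>m\<close> is left. Dividing them bounds
    \<open>i + m\<close>, multiplying them isolates \<open>i\<close>.\<close>
  have b': "\<alpha> ^ i = \<beta> ^ m" and c': "\<beta> ^ i = \<alpha> ^ m"
    using b c j k by (simp_all add: pow_dvd power_divide)
  have "(\<alpha> / \<beta>) ^ (i + m) = 1"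
    by (simp add: power_add power_divide b' c')
  then have im: "l dvd i + m" by (rule div_pow)
  have "(\<alpha> * \<beta>) ^ i = \<alpha> ^ (i + m)" by (simp add: power_mult_distrib power_add c')
  then have i: "l dvd i" using im mult_pow by (simp add: pow_dvd)
  with im have "l dvd m" by (simp add: dvd_add_right_iff)
  with i j k show ?thesis by simp
qed

text \<open>For a monomial with exponents divisible by \<open>l\<close>, and also for one whose total degree in
  \<open>X12\<close> and \<open>X21\<close> is minimal among the others, the correction terms of multiplication by \<open>X11\<close>
  and by \<open>X22\<close> do not interfere with the leading coefficients.\<close>

lemma keys_nf_central:
  assumes "nf_central v" "x \<in> keys v"
  shows "l_exps x"
proof (rule ccontr)
  assume "\<not> l_exps x"
  define S where "S = {x \<in> keys v. \<not> l_exps x}"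
  define deg :: "exps \<Rightarrow> nat" where "deg = (\<lambda>(i, j, k, m). j + k)"
  have "x \<in> S" using assms \<open>\<not> l_exps x\<close> by (simp add: S_def)
  moreover have "finite S" by (simp add: S_def)
  ultimately have "\<exists>x. is_arg_min deg (\<lambda>x. x \<in> S) x"
    using ex_is_arg_min_if_finite[of S deg] by blast
  then obtain x\<^sub>0 where "x\<^sub>0 \<in> S" and min\<^sub>0: "\<And>x. x \<in> S \<Longrightarrow> deg x\<^sub>0 \<le> deg x"
    unfolding is_arg_min_linorder by blast
  moreover obtain i j k m where x\<^sub>0: "x\<^sub>0 = (i, j, k, m)" by (cases x\<^sub>0) auto
  ultimately have x: "(i, j, k, m) \<in> keys v" "\<not> l_exps (i, j, k, m)"
    and min: "\<And>x. x \<in> S \<Longrightarrow> j + k \<le> deg x"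
    using min\<^sub>0 by (auto simp only: S_def x\<^sub>0 deg_def mem_Collect_eq prod.case)
  \<comment> \<open>If no other key of \<open>v\<close> contributes at \<open>y\<close>, both sides
    are multiples of the coefficient of \<open>v\<close> at \<open>(i, j, k, m)\<close>, which is
    nonzero and cancels.\<close>
  have coeff: "lookup (lmul_mon g (i, j, k, m)) y = lookup (rmul_mon g (i, j, k, m)) y"
    if "\<And>x'. x' \<in> keys v \<Longrightarrow> x' \<noteq> (i, j, k, m) \<Longrightarrow>
      lookup (lmul_mon g x') y = 0 \<and> lookup (rmul_mon g x') y = 0" for g y
  proof -
    have "lookup (lext (lmul_mon g) v) y = lookup (lext (rmul_mon g) v) y"
      using assms(1) by (simp add: nf_central_def lmul_def rmul_def)
    then show ?thesis
      using x(1) that lookup_lext_isolated[OF x(1), of "lmul_mon g" y]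
        lookup_lext_isolated[OF x(1), of "rmul_mon g" y]
      by (simp add: in_keys_iff del: lmul_mon.simps rmul_mon.simps)
  qed
  \<comment> \<open>A correction raises the degree by 2. Hence it either has coefficient zero or
    lands in degree at least \<open>j + k + 2\<close>, away from the leading monomials for
    \<open>X11\<close> and \<open>X22\<close>, which have degree \<open>j + k\<close>.\<close>
  have other: "cc i' = 0 \<and> cc m' = 0 \<or> j + k \<le> j' + k'" if "(i', j', k', m') \<in> keys v" for i' j' k' m'
    using that min[of "(i', j', k', m')"]
    by (cases "l_exps (i', j', k', m')") (simp_all add: S_def deg_def pow_dvd)
  have "1 = \<alpha> ^ j * \<beta> ^ k"
  proof -
    have "lookup (lmul_mon X11 x') (Suc i, j, k, m) = 0 \<and> lookup (rmul_mon X11 x') (Suc i, j, k, m) = 0"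
      if "x' \<in> keys v" "x' \<noteq> (i, j, k, m)" for x'
    proof -
      obtain i' j' k' m' where x': "x' = (i', j', k', m')" by (cases x') auto
      show ?thesis
        using that other[of i' j' k' m'] by (auto simp: x' lookup_add lookup_single when_def)
    qed
    from coeff[OF this] show ?thesis by (simp add: lookup_add lookup_single)
  qed
  moreover have "\<beta> ^ j * \<alpha> ^ k = 1"
  proof -
    have "lookup (lmul_mon X22 x') (i, j, k, Suc m) = 0 \<and> lookup (rmul_mon X22 x') (i, j, k, Suc m) = 0"
      if "x' \<in> keys v" "x' \<noteq> (i, j, k, m)" for x'
    proof -
      obtain i' j' k' m' where x': "x' = (i', j', k', m')" by (cases x') auto
      show ?thesis
        using that other[of i' j' k' m'] by (auto simp: x' lookup_add lookup_single when_def)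
    qed
    from coeff[OF this] show ?thesis by (simp add: lookup_add lookup_single)
  qed
  \<comment> \<open>Multiplication by \<open>X12\<close> or \<open>X21\<close> has no correction, so
    distinct monomials go to multiples of distinct monomials.\<close>
  moreover have "\<alpha> ^ i = \<beta> ^ m * (\<beta> / \<alpha>) ^ k"
  proof -
    have "lookup (lmul_mon X12 x') (i, Suc j, k, m) = 0 \<and> lookup (rmul_mon X12 x') (i, Suc j, k, m) = 0"
      if "x' \<in> keys v" "x' \<noteq> (i, j, k, m)" for x'
    proof -
      obtain i' j' k' m' where x': "x' = (i', j', k', m')" by (cases x') auto
      show ?thesis
        using that by (auto simp: x' lookup_single when_def)
    qed
    from coeff[OF this] show ?thesis by (simp add: lookup_single)
  qed
  moreover have "\<beta> ^ i * (\<beta> / \<alpha>) ^ j = \<alpha> ^ m"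
  proof -
    have "lookup (lmul_mon X21 x') (i, j, Suc k, m) = 0 \<and> lookup (rmul_mon X21 x') (i, j, Suc k, m) = 0"
      if "x' \<in> keys v" "x' \<noteq> (i, j, k, m)" for x'
    proof -
      obtain i' j' k' m' where x': "x' = (i', j', k', m')" by (cases x') auto
      show ?thesis
        using that by (auto simp: x' lookup_single when_def)
    qed
    from coeff[OF this] show ?thesis by (simp add: lookup_single)
  qed
  ultimately show False
    using l_exps_if_power_relations x(2) by metis
qed

section \<open>The polynomial ring in the powers with exponent \<open>l\<close>\<close>

definition scaled_exps :: "(mgen \<Rightarrow>\<^sub>0 nat) \<Rightarrow> exps" where
  "scaled_exps e = (l * lookup e X11, l * lookup e X12, l * lookup e X21, l * lookup e X22)"

lemma l_exps_scaled_exps [simp]: "l_exps (scaled_exps e)"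
  by (simp add: scaled_exps_def)

lemma inj_scaled_exps: "inj scaled_exps"
proof (rule injI)
  fix e e' assume "scaled_exps e = scaled_exps e'"
  then have "lookup e g = lookup e' g" for g
    using l_pos by (cases g) (simp_all add: scaled_exps_def)
  then show "e = e'" by (rule poly_mapping_eqI)
qed

lemma l_exps_in_range: "l_exps x \<Longrightarrow> x \<in> range scaled_exps"
proof -
  assume "l_exps x"
  then obtain i j k m where x: "x = (l * i, l * j, l * k, l * m)"
    by (cases x) (auto elim!: dvdE)
  let ?s = Poly_Mapping.single
  have "x = scaled_exps (?s X11 i + ?s X12 j + ?s X21 k + ?s X22 m)"
    by (simp add: x scaled_exps_def lookup_add lookup_single)
  then show ?thesis by blast
qed

text \<open>The normal form of a polynomial evaluated at the \<open>l\<close>-th powers of the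
  generators. It is set up as a linear map, and its compatibility with products is shown
  separately.\<close>

definition emb :: "(mgen, 'k) mpoly \<Rightarrow> exps \<Rightarrow>\<^sub>0 'k" where
  "emb = lext (\<lambda>e. mon (scaled_exps e))"

lemma inj_emb: "inj emb"
proof (rule inj_on_inverseI)
  fix P
  show "lext (\<lambda>x. mon (inv_into UNIV scaled_exps x)) (emb P) = P"
    by (simp add: emb_def lext_lext inj_scaled_exps)
qed

text \<open>One inclusion is the centrality of monomials with exponents divisible by
  \<open>l\<close>. For the other, \<open>keys_nf_central\<close> puts the whole support of a
  central vector into the range of \<open>scaled_exps\<close>.\<close>

lemma range_emb: "range emb = {v. nf_central v}"
proof (intro equalityI subsetI CollectI)
  fix v assume "v \<in> range emb"
  then obtain P where v: "v = emb P" by blast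
  have "lext (lmul_mon g) (emb P) = lext (rmul_mon g) (emb P)" for g
    by (simp add: emb_def lext_lext lmul_eq_rmul_l_exps)
  then show "nf_central v" by (simp add: v nf_central_def lmul_def rmul_def)
next
  fix v assume "v \<in> {v. nf_central v}"
  then have *: "scaled_exps (inv_into UNIV scaled_exps x) = x" if "x \<in> keys v" for x
    using keys_nf_central[of v x] that by (simp add: f_inv_into_f l_exps_in_range)
  have "emb (lext (\<lambda>x. mon (inv_into UNIV scaled_exps x)) v) = lext (\<lambda>x. mon (scaled_exps (inv_into UNIV scaled_exps x))) v"
    by (simp add: emb_def lext_lext)
  also have "\<dots> = lext mon v" by (rule lext_cong) (simp add: *)
  finally have "v = emb (lext (\<lambda>x. mon (inv_into UNIV scaled_exps x)) v)" by simp
  then show "v \<in> range emb" by (rule range_eqI)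
qed

text \<open>Both sides are bilinear, so monomials suffice; there the exponents simply add.\<close>

lemma nf_lift_emb_mult: "nf (lift (emb P) * lift (emb P')) = emb (P * P')"
proof (induction P rule: poly_mapping_add_induct)
  case (single e c)
  show ?case
  proof (induction P' rule: poly_mapping_add_induct)
    case (single e' c')
    have "nf (ordmon (scaled_exps e) * ordmon (scaled_exps e')) = mon (scaled_exps (e + e'))"
      unfolding scaled_exps_def
      by (subst nf_ordmon_mult_l_exps) (simp_all add: lookup_add algebra_simps)
    then show ?case
      by (simp add: emb_def lift_def mult_single smul_mult_left smul_mult_right nf_smul
          mult.commute[of c])
  next
    case (add P' P'')
    then show ?case
      by (simp add: emb_def lift_def lext_add distrib_left nf_add)
  qed
next
  case (add P P'')
  then show ?case
    by (simp add: emb_def lift_def lext_add distrib_right nf_add)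
qed

theorem polynomial_algebra_on_center:
  "polynomial_algebra_on (Q\<lparr>carrier := ring_center Q\<rparr>) (qmat_scalar \<alpha> \<beta>)
     (\<lambda>g. qmat_gen \<alpha> \<beta> g [^]\<^bsub>Q\<^esub> l)"
proof -
  \<comment> \<open>Here \<open>emb\<close> is a bijection onto the central normal forms, and
    \<open>lift\<close> followed by \<open>cls\<close> turns normal forms bijectively into elements
    of the quotient.\<close>
  let ?\<phi> = "\<lambda>P. cls (lift (emb P))"
  have center: "?\<phi> P \<in> ring_center Q" for P
    using range_emb by (auto simp: cls_center_iff)
  have const: "?\<phi> (mp_const c) = qmat_scalar \<alpha> \<beta> c" for c
  proof -
    have "lift (emb (mp_const c)) = smul c 1"
      by (simp add: mp_const_def emb_def lift_def scaled_exps_def)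
    also have "\<dots> = fa_scalar c" by (metis fa_scalar_mult mult_1_right)
    finally show ?thesis by (simp add: qmat_scalar_def)
  qed
  have var: "?\<phi> (mp_var g) = qmat_gen \<alpha> \<beta> g [^]\<^bsub>Q\<^esub> l" for g
  proof -
    have "lift (emb (mp_var g)) = fa_gen g ^ l"
      by (cases g) (simp_all add: mp_var_def emb_def scaled_exps_def lookup_single)
    then show ?thesis by (simp add: qmat_gen_def cls_pow)
  qed
  have one: "?\<phi> 1 = \<one>\<^bsub>Q\<^esub>"
    using const[of 1] by (simp add: mp_const_def qmat_scalar_def fa_scalar_def cls_one)
  have mult: "?\<phi> (P * P') = ?\<phi> P \<otimes>\<^bsub>Q\<^esub> ?\<phi> P'" for P P'
    by (simp add: cls_eq_iff nf_lift_emb_mult flip: cls_mult)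
  have add: "?\<phi> (P + P') = ?\<phi> P \<oplus>\<^bsub>Q\<^esub> ?\<phi> P'" for P P'
    by (simp add: emb_def lift_def lext_add flip: cls_add)
  have inj: "inj ?\<phi>"
  proof (rule injI)
    fix P P' assume "?\<phi> P = ?\<phi> P'"
    then have "emb P = emb P'" by (simp add: cls_eq_iff)
    then show "P = P'" by (rule injD[OF inj_emb])
  qed
  have surj: "ring_center Q \<subseteq> range ?\<phi>"
  proof
    fix z assume z: "z \<in> ring_center Q"
    then have "z \<in> range cls" by (simp add: ring_center_def carrier_Q)
    then obtain f where f: "z = cls f" by blast
    have "nf f \<in> range emb" using z unfolding f cls_center_iff range_emb by (rule CollectI)
    then obtain P where "nf f = emb P" by blast
    then have "z = ?\<phi> P" by (simp add: f cls_eq_iff)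
    then show "z \<in> range ?\<phi>" by (rule range_eqI)
  qed
  have bij: "bij_betw ?\<phi> UNIV (ring_center Q)"
    unfolding bij_betw_def using inj surj center by blast
  have "?\<phi> \<in> ring_iso ring_of_type_algebra (Q\<lparr>carrier := ring_center Q\<rparr>)"
    by (rule ring_iso_memI) (simp_all add: ring_of_type_algebra_def center one mult add bij)
  then show ?thesis
    unfolding polynomial_algebra_on_def by (intro bexI[of _ ?\<phi>] conjI allI const var)
qed

end

section \<open>From orders of roots of unity to divisibility\<close>

lemma mult_ord_dvd_iff:
  fixes \<xi> :: "'k::field"
  assumes "\<xi> \<noteq> 0"
  shows "\<xi> ^ n = 1 \<longleftrightarrow> mult_ord \<xi> dvd n"
proof -
  let ?R = "ring_of_type_algebra :: 'k ring"
  \<comment> \<open>Unfolding both constants named \<open>mult_of\<close> shows that they give the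
    same group of nonzero elements.\<close>
  interpret group "mult_of ?R"
    using field.field_mult_group[of ?R] field_from_type_algebra
    by (simp add: Ring_Divisibility.mult_of_def Multiplicative_Group.mult_of_def)
  have "\<xi> [^]\<^bsub>mult_of ?R\<^esub> n = \<xi> ^ n"
    by (induction n) (simp_all add: ring_of_type_algebra_def mult.commute)
  then show ?thesis
    using pow_eq_id[of \<xi> n] assms by (simp add: mult_ord_def ring_of_type_algebra_def)
qed

theorem corollary3p3:
  fixes \<alpha> \<beta> :: "'k::alg_closed_field" and l :: nat
  assumes "\<alpha> \<noteq> 0" and "\<beta> \<noteq> 0"
    and "\<exists>n>0. \<alpha> ^ n = 1" and "\<exists>n>0. \<beta> ^ n = 1"
    and "\<alpha> * \<beta> \<noteq> 1" and "\<alpha> * inverse \<beta> \<noteq> 1"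
    and "l = lcm (mult_ord \<alpha>) (mult_ord \<beta>)"
    and "mult_ord (\<alpha> * \<beta>) = l" and "mult_ord (\<alpha> * inverse \<beta>) = l"
  shows "polynomial_algebra_on
    ((qmat \<alpha> \<beta>)\<lparr>carrier := ring_center (qmat \<alpha> \<beta>)\<rparr>)
    (qmat_scalar \<alpha> \<beta>)
    (\<lambda>g. qmat_gen \<alpha> \<beta> g [^]\<^bsub>qmat \<alpha> \<beta>\<^esub> l)"
proof -
  \<comment> \<open>An order 0 would divide only 0, whereas each parameter has a positive power
    equal to 1. This makes \<open>l\<close> positive.\<close>
  have "mult_ord \<alpha> \<noteq> 0" "mult_ord \<beta> \<noteq> 0"
    using assms(1-4) by (auto simp: mult_ord_dvd_iff)
  then interpret quantum_matrices_root \<alpha> \<beta> l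
    using assms
    by unfold_locales (auto simp: mult_ord_dvd_iff divide_inverse lcm_pos_nat)
  show ?thesis by (rule polynomial_algebra_on_center)
qed

end
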